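(* Let $\bar x\notin\Omega$ with $T^F_\Omega(\bar x)<\infty$, and let the minimal time function $T^F_\Omega$ be well posed at $\bar x$. Then $$\partial T^F_\Omega(\bar x)\subset\bigcup_{\bar w\in\Pi^F_\Omega(\bar x)}\big[-\partial\rho_F(\bar w-\bar x)\cap N(\bar w;\Omega)\big]$$ and $$\partial^\infty T^F_\Omega(\bar x)\subset\bigcup_{\bar w\in\Pi^F_\Omega(\bar x)}\big[-\partial^\infty\rho_F(\bar w-\bar x)\cap N(\bar w;\Omega)\big]\subset\bigcup_{\bar w\in\Pi^F_\Omega(\bar x)}\big[N(\bar w;\Omega)\cap F^*_+\big].$$
   Context: $X$ is an arbitrary (real) Banach space with topological dual $X^*$ and pairing $\langle\cdot,\cdot\rangle$; $\xrightarrow{w^*}$ denotes weak$^*$ convergence of sequences in $X^*$. Standing assumptions: $\Omega\subset X$ is nonempty and closed; $F\subset X$ is nonempty, closed, bounded and convex (it is not assumed that $0\in\mathrm{int}\,F$). The minimal time function is $T^F_\Omega(x):=\inf\{t\ge 0\mid \Omega\cap(x+tF)\ne\emptyset\}\in[0,\infty]$ and the Minkowski gauge is $\rho_F(u):=\inf\{t\ge0\mid u\in tF\}\in[0,\infty]$, with $\inf\emptyset=\infty$. For $x$ with $T^F_\Omega(x)<\infty$ the (generalized) projection is $\Pi^F_\Omega(x):=(x+T^F_\Omega(x)F)\cap\Omega$. The positive dual cone of $F$ is $F^*_+:=\{x^*\in X^*\mid\langle x^*,v\rangle\ge0\text{ for all }v\in F\}$. Well-posedness: $T^F_\Omega$ is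 well posed at $\bar x\notin\Omega$ with $T^F_\Omega(\bar x)<\infty$ if for any sequence $x_k\to\bar x$ with $T^F_\Omega(x_k)\to T^F_\Omega(\bar x)$ there is a sequence of projection points $w_k\in\Pi^F_\Omega(x_k)$ containing a convergent subsequence. For $\varepsilon\ge0$ and $\Theta\subset X$, the set of $\varepsilon$-normals at $x\in\Theta$ is $\widehat N_\varepsilon(x;\Theta):=\{x^*\in X^*\mid \limsup_{u\to x,\,u\in\Theta}\frac{\langle x^*,u-x\rangle}{\|u-x\|}\le\varepsilon\}$, and $\widehat N_\varepsilon(x;\Theta):=\emptyset$ if $x\notin\Theta$. The basic (limiting) normal cone $N(\bar x;\Theta)$ is the set of $x^*\in X^*$ for which there are sequences $\varepsilon_k\downarrow0$, $x_k\to\bar x$, $x_k^*\xrightarrow{w^*}x^*$ with $x_k^*\in\widehat N_{\varepsilon_k}(x_k;\Theta)$ for all $k$. For $\varphi:X\to(-\infty,\infty]$ and $x$ with $\varphi(x)<\infty$, $\widehat\partial_\varepsilon\varphi(x):=\{x^*\in X^*\mid\liminf_{u\to x}\frac{\varphi(u)-\varphi(x)-\langle x^*,u-x\rangle}{\|u-x\|}\ge-\varepsilon\}$. For $\varphi(\bar x)<\infty$: the basic subdifferential $\partial\varphi(\bar x)$ is the set of $x^*$ for which there are sequences $\varepsilon_k\downarrow0$, $x_k\to\bar x$ with $\varphi(x_k)\to\varphi(\bar x)$, and $x_k^*\in\widehat\partial_{\varepsilon_k}\varphi(x_k)$ with $x_k^*\xrightarrow{w^*}x^*$; the singular subdifferential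 $\partial^\infty\varphi(\bar x)$ is the set of $x^*$ for which there are sequences $\varepsilon_k\downarrow0$, $\lambda_k\downarrow0$ ($\lambda_k>0$), $x_k\to\bar x$ with $\varphi(x_k)\to\varphi(\bar x)$, and $x_k^*\in\widehat\partial_{\varepsilon_k}\varphi(x_k)$ with $\lambda_kx_k^*\xrightarrow{w^*}x^*$. For a set $A\subset X^*$, $-A:=\{-a\mid a\in A\}$. *)

theory Defs
  imports "HOL-Analysis.Analysis"
begin

definition min_time :: "'a::real_normed_vector set \<Rightarrow> 'a set \<Rightarrow> 'a \<Rightarrow> ereal" where
  "min_time F \<Omega> x = Inf {ereal t |t. t \<ge> 0 \<and> \<Omega> \<inter> (\<lambda>v. x + t *\<^sub>R v) ` F \<noteq> {}}"

definition gauge_fun :: "'a::real_normed_vector set \<Rightarrow> 'a \<Rightarrow> ereal" where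
  "gauge_fun F u = Inf {ereal t |t. t \<ge> 0 \<and> u \<in> (\<lambda>v. t *\<^sub>R v) ` F}"

text \<open>The projection only makes sense where the minimal time is finite; the guard is needed
  because \<^term>\<open>real_of_ereal \<infinity> = 0\<close>.\<close>

definition gen_proj :: "'a::real_normed_vector set \<Rightarrow> 'a set \<Rightarrow> 'a \<Rightarrow> 'a set" where
  "gen_proj F \<Omega> x =
     (if min_time F \<Omega> x < \<infinity>
      then (\<lambda>v. x + real_of_ereal (min_time F \<Omega> x) *\<^sub>R v) ` F \<inter> \<Omega>
      else {})"

definition dual_cone :: "'a::real_normed_vector set \<Rightarrow> ('a \<Rightarrow>\<^sub>L real) set" where
  "dual_cone F = {f. \<forall>v\<in>F. blinfun_apply f v \<ge> 0}"

text \<open>The sequences range over points of finite minimal time, where projections are defined.\<close>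

definition well_posed_at :: "'a::real_normed_vector set \<Rightarrow> 'a set \<Rightarrow> 'a \<Rightarrow> bool" where
  "well_posed_at F \<Omega> xbar \<longleftrightarrow>
     (\<forall>x :: nat \<Rightarrow> 'a.
        x \<longlonglongrightarrow> xbar \<and> (\<forall>k. min_time F \<Omega> (x k) < \<infinity>) \<and>
        (\<lambda>k. min_time F \<Omega> (x k)) \<longlonglongrightarrow> min_time F \<Omega> xbar \<longrightarrow>
        (\<exists>w. (\<forall>k. w k \<in> gen_proj F \<Omega> (x k)) \<and>
             (\<exists>r :: nat \<Rightarrow> nat. strict_mono r \<and> convergent (w \<circ> r))))"

definition weak_star_tendsto ::
  "(nat \<Rightarrow> ('a::real_normed_vector \<Rightarrow>\<^sub>L real)) \<Rightarrow> ('a \<Rightarrow>\<^sub>L real) \<Rightarrow> bool" where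
  "weak_star_tendsto f g \<longleftrightarrow>
     (\<forall>v. (\<lambda>k. blinfun_apply (f k) v) \<longlonglongrightarrow> blinfun_apply g v)"

text \<open>At an isolated point of \<open>\<Theta>\<close> the filter is trivial, so that the upper limit is \<open>-\<infinity>\<close> and every
  functional is an \<open>\<epsilon>\<close>-normal.\<close>

definition eps_normals ::
  "real \<Rightarrow> 'a::real_normed_vector set \<Rightarrow> 'a \<Rightarrow> ('a \<Rightarrow>\<^sub>L real) set" where
  "eps_normals \<epsilon> \<Theta> x =
     {f. x \<in> \<Theta> \<and>
         Limsup (at x within \<Theta>) (\<lambda>u. ereal (blinfun_apply f (u - x) / norm (u - x))) \<le> ereal \<epsilon>}"

text \<open>Here and below \<open>\<epsilon>\<^sub>k \<down> 0\<close> means convergence to zero through nonnegative values. Monotonicity is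
  not demanded; it could be obtained by passing to a subsequence.\<close>

definition normal_cone :: "'a::real_normed_vector set \<Rightarrow> 'a \<Rightarrow> ('a \<Rightarrow>\<^sub>L real) set" where
  "normal_cone \<Theta> xbar =
     {f. \<exists>\<epsilon> x g. (\<forall>k. 0 \<le> \<epsilon> k) \<and> \<epsilon> \<longlonglongrightarrow> 0 \<and> x \<longlonglongrightarrow> xbar \<and>
           (\<forall>k. g k \<in> eps_normals (\<epsilon> k) \<Theta> (x k)) \<and> weak_star_tendsto g f}"

text \<open>The functions \<open>\<phi>\<close> of interest never take the value \<open>-\<infinity>\<close>, hence \<open>\<phi> x < \<infinity>\<close> expresses finiteness
  and the subtractions below are never of the form \<open>\<infinity> - \<infinity>\<close>.\<close>

definition eps_subdiff ::
  "real \<Rightarrow> ('a::real_normed_vector \<Rightarrow> ereal) \<Rightarrow> 'a \<Rightarrow> ('a \<Rightarrow>\<^sub>L real) set" where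
  "eps_subdiff \<epsilon> \<phi> x =
     {f. \<phi> x < \<infinity> \<and>
         Liminf (at x)
           (\<lambda>u. (\<phi> u - \<phi> x - ereal (blinfun_apply f (u - x))) / ereal (norm (u - x)))
         \<ge> ereal (- \<epsilon>)}"

definition basic_subdiff ::
  "('a::real_normed_vector \<Rightarrow> ereal) \<Rightarrow> 'a \<Rightarrow> ('a \<Rightarrow>\<^sub>L real) set" where
  "basic_subdiff \<phi> xbar =
     {f. \<phi> xbar < \<infinity> \<and>
         (\<exists>\<epsilon> x g. (\<forall>k. 0 \<le> \<epsilon> k) \<and> \<epsilon> \<longlonglongrightarrow> 0 \<and>
            x \<longlonglongrightarrow> xbar \<and> (\<lambda>k. \<phi> (x k)) \<longlonglongrightarrow> \<phi> xbar \<and>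
            (\<forall>k. g k \<in> eps_subdiff (\<epsilon> k) \<phi> (x k)) \<and> weak_star_tendsto g f)}"

definition singular_subdiff ::
  "('a::real_normed_vector \<Rightarrow> ereal) \<Rightarrow> 'a \<Rightarrow> ('a \<Rightarrow>\<^sub>L real) set" where
  "singular_subdiff \<phi> xbar =
     {f. \<phi> xbar < \<infinity> \<and>
         (\<exists>\<epsilon> \<mu> x g. (\<forall>k. 0 \<le> \<epsilon> k) \<and> \<epsilon> \<longlonglongrightarrow> 0 \<and>
            (\<forall>k. 0 < \<mu> k) \<and> \<mu> \<longlonglongrightarrow> 0 \<and>
            x \<longlonglongrightarrow> xbar \<and> (\<lambda>k. \<phi> (x k)) \<longlonglongrightarrow> \<phi> xbar \<and>
            (\<forall>k. g k \<in> eps_subdiff (\<epsilon> k) \<phi> (x k)) \<and>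
            weak_star_tendsto (\<lambda>k. \<mu> k *\<^sub>R g k) f)}"

end

theory Submission
  imports Defs
begin

text \<open>
  Write \<open>T\<close> for the minimal time function and \<open>\<rho>\<close> for the gauge of \<open>F\<close>. Since \<open>T x\<close> is the infimum
  of \<open>\<rho> (w - x)\<close> over \<open>w \<in> \<Omega>\<close>, attained at the points of the projection, moving \<open>x\<close> or \<open>w\<close> around a
  pair \<open>w \<in> \<Pi> x\<close> gives two inequalities:
  \<open>T (x - h) \<le> \<rho> ((w - x) + h)\<close> for all \<open>h\<close>, and \<open>T (x + (u - w)) \<le> \<rho> (w - x)\<close> for all \<open>u \<in> \<Omega>\<close>,
  both with equality at zero displacement. The first turns an \<open>\<epsilon>\<close>-subgradient \<open>f\<close> of \<open>T\<close> at \<open>x\<close> into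
  the \<open>\<epsilon>\<close>-subgradient \<open>- f\<close> of \<open>\<rho>\<close> at \<open>w - x\<close>; the second makes \<open>f\<close> an \<open>\<epsilon>\<close>-normal to \<open>\<Omega>\<close> at \<open>w\<close>
  (lemmas \<open>eps_subdiff_min_time_imp_gauge\<close> and \<open>eps_subdiff_min_time_imp_normal\<close>).

  Well-posedness is what allows these facts to pass to the limit: along a sequence \<open>x\<^sub>k\<close> that
  defines a limiting subgradient, a subsequence of projection points \<open>w\<^sub>k\<close> converges. The limit is
  a projection of the reference point because \<open>T\<close> is positive there, so that the directions
  \<open>(w\<^sub>k - x\<^sub>k) / T x\<^sub>k \<in> F\<close> converge as well (lemma \<open>well_posed_projections\<close>).

  The last inclusion depends on \<open>\<rho>\<close> only. By convexity of \<open>F\<close>, \<open>\<rho>\<close> grows at rate at most one in every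
  direction \<open>v \<in> F\<close>, so an \<open>\<epsilon>\<close>-subgradient \<open>g\<close> of \<open>\<rho>\<close> satisfies \<open>g v \<le> 1 + \<epsilon> * norm v\<close>. Multiplying by
  scalars tending to zero leaves \<open>\<le> 0\<close> in the limit.
\<close>

section \<open>Difference-quotient-free forms of the approximate normals and subgradients\<close>

text \<open>The quotients in the limits are cleared of their denominators once and for all; both
  conditions become local inequalities that can be compared by monotonicity.\<close>

lemma mem_eps_subdiff_iff:
  fixes \<phi> :: "'a::real_normed_vector \<Rightarrow> ereal"
  assumes fin: "\<bar>\<phi> x\<bar> \<noteq> \<infinity>"
  shows "f \<in> eps_subdiff \<epsilon> \<phi> x \<longleftrightarrow>
     (\<forall>\<delta>>\<epsilon>. \<exists>d>0. \<forall>h. norm h < d \<longrightarrow>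
        \<phi> x + ereal (blinfun_apply f h - \<delta> * norm h) \<le> \<phi> (x + h))"
proof -
  obtain c where c: "\<phi> x = ereal c" using fin by auto
  let ?Q = "\<lambda>u. (\<phi> u - \<phi> x - ereal (blinfun_apply f (u - x))) / ereal (norm (u - x))"
  have quot_less: "ereal (-\<delta>) < ?Q u \<longleftrightarrow> \<phi> x + ereal (blinfun_apply f (u - x) - \<delta> * norm (u - x)) < \<phi> u"
    if "u \<noteq> x" for u \<delta>
    using that by (cases "\<phi> u") (auto simp: c field_simps)
  have quot_le: "ereal (-\<delta>) \<le> ?Q u \<longleftrightarrow> \<phi> x + ereal (blinfun_apply f (u - x) - \<delta> * norm (u - x)) \<le> \<phi> u"
    if "u \<noteq> x" for u \<delta>
    using that by (cases "\<phi> u") (auto simp: c field_simps)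
  show ?thesis
  proof
    assume f: "f \<in> eps_subdiff \<epsilon> \<phi> x"
    show "\<forall>\<delta>>\<epsilon>. \<exists>d>0. \<forall>h. norm h < d \<longrightarrow>
        \<phi> x + ereal (blinfun_apply f h - \<delta> * norm h) \<le> \<phi> (x + h)"
    proof (intro allI impI)
      fix \<delta> assume "\<epsilon> < \<delta>"
      then have "\<forall>\<^sub>F u in at x. ereal (-\<delta>) < ?Q u"
        using f by (auto simp: eps_subdiff_def le_Liminf_iff)
      then obtain d where "d > 0"
        and d: "\<And>u. u \<noteq> x \<Longrightarrow> dist u x < d \<Longrightarrow> ereal (-\<delta>) < ?Q u"
        by (auto simp: eventually_at)
      have "\<phi> x + ereal (blinfun_apply f h - \<delta> * norm h) \<le> \<phi> (x + h)" if "norm h < d" for h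
      proof (cases "h = 0")
        case False
        then show ?thesis
          using d[of "x + h"] quot_less[of "x + h" \<delta>] that by (simp add: dist_norm less_imp_le)
      qed (simp add: c)
      then show "\<exists>d>0. \<forall>h. norm h < d \<longrightarrow>
        \<phi> x + ereal (blinfun_apply f h - \<delta> * norm h) \<le> \<phi> (x + h)"
        using \<open>d > 0\<close> by blast
    qed
  next
    assume R: "\<forall>\<delta>>\<epsilon>. \<exists>d>0. \<forall>h. norm h < d \<longrightarrow>
        \<phi> x + ereal (blinfun_apply f h - \<delta> * norm h) \<le> \<phi> (x + h)"
    have "ereal (-\<epsilon>) \<le> Liminf (at x) ?Q"
    proof (rule ereal_le_epsilon2)
      fix e :: real assume "0 < e"
      then obtain d where "d > 0" and d: "\<And>h. norm h < d \<Longrightarrow>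
          \<phi> x + ereal (blinfun_apply f h - (\<epsilon> + e) * norm h) \<le> \<phi> (x + h)"
        using R[rule_format, of "\<epsilon> + e"] by auto
      have "\<forall>\<^sub>F u in at x. ereal (-(\<epsilon> + e)) \<le> ?Q u"
        unfolding eventually_at
        using \<open>d > 0\<close> d[of "u - x" for u] quot_le[of _ "\<epsilon> + e"]
        by (intro exI[of _ d]) (auto simp: dist_norm)
      then have "ereal (-(\<epsilon> + e)) \<le> Liminf (at x) ?Q"
        by (rule Liminf_bounded)
      then show "ereal (-\<epsilon>) \<le> Liminf (at x) ?Q + ereal e"
        by (cases "Liminf (at x) ?Q") auto
    qed
    then show "f \<in> eps_subdiff \<epsilon> \<phi> x"
      by (simp add: eps_subdiff_def c)
  qed
qed

lemma eps_normalsI: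
  fixes \<Theta> :: "'a::real_normed_vector set"
  assumes "x \<in> \<Theta>"
    and R: "\<And>\<delta>. \<delta> > \<epsilon> \<Longrightarrow> \<exists>d>0. \<forall>u\<in>\<Theta>. norm (u - x) < d \<longrightarrow> blinfun_apply f (u - x) \<le> \<delta> * norm (u - x)"
  shows "f \<in> eps_normals \<epsilon> \<Theta> x"
proof -
  let ?Q = "\<lambda>u. ereal (blinfun_apply f (u - x) / norm (u - x))"
  have "Limsup (at x within \<Theta>) ?Q \<le> ereal \<epsilon>"
  proof (rule ereal_le_epsilon2)
    fix e :: real assume "0 < e"
    then obtain d where "d > 0"
      and d: "\<And>u. u \<in> \<Theta> \<Longrightarrow> norm (u - x) < d \<Longrightarrow> blinfun_apply f (u - x) \<le> (\<epsilon> + e) * norm (u - x)"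
      using R[of "\<epsilon> + e"] by auto
    have "\<forall>\<^sub>F u in at x within \<Theta>. ?Q u \<le> ereal (\<epsilon> + e)"
      unfolding eventually_at
      using \<open>d > 0\<close> d by (intro exI[of _ d]) (auto simp: dist_norm divide_le_eq)
    then show "Limsup (at x within \<Theta>) ?Q \<le> ereal \<epsilon> + ereal e"
      by (simp add: Limsup_bounded)
  qed
  then show ?thesis using \<open>x \<in> \<Theta>\<close> by (simp add: eps_normals_def)
qed

lemma weak_star_tendsto_uminus:
  "weak_star_tendsto g f \<Longrightarrow> weak_star_tendsto (\<lambda>k. - g k) (- f)"
  by (auto simp: weak_star_tendsto_def blinfun.minus_left intro: tendsto_minus)

lemma weak_star_tendsto_subseq:
  assumes "weak_star_tendsto g f" and "strict_mono r"
  shows "weak_star_tendsto (\<lambda>k. g (r k)) f"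
  using assms LIMSEQ_subseq_LIMSEQ[OF _ assms(2)]
  by (fastforce simp: weak_star_tendsto_def o_def)

section \<open>Minimal time, gauge and projections\<close>

lemma min_time_nonneg: "0 \<le> min_time F \<Omega> x"
  by (auto simp: min_time_def intro!: Inf_greatest)

lemma gauge_fun_nonneg: "0 \<le> gauge_fun F u"
  by (auto simp: gauge_fun_def intro!: Inf_greatest)

lemma min_time_le_gauge:
  assumes "w \<in> \<Omega>"
  shows "min_time F \<Omega> x \<le> gauge_fun F (w - x)"
  unfolding min_time_def gauge_fun_def
proof (rule Inf_superset_mono, safe)
  fix t v assume "0 \<le> (t::real)" "w - x = t *\<^sub>R v" "v \<in> F"
  then have "w = x + t *\<^sub>R v"
    by (simp add: algebra_simps)
  then show "\<exists>t'. ereal t = ereal t' \<and> 0 \<le> t' \<and> \<Omega> \<inter> (\<lambda>v. x + t' *\<^sub>R v) ` F \<noteq> {}"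
    using assms \<open>0 \<le> t\<close> \<open>v \<in> F\<close> by blast
qed

lemma gen_proj_gauge_eq:
  assumes "w \<in> gen_proj F \<Omega> x"
  shows "gauge_fun F (w - x) = min_time F \<Omega> x"
proof (rule antisym)
  have fin: "min_time F \<Omega> x < \<infinity>" and "w \<in> \<Omega>"
    using assms by (auto simp: gen_proj_def split: if_splits)
  obtain t where t: "min_time F \<Omega> x = ereal t" "0 \<le> t"
    using fin min_time_nonneg[of F \<Omega> x] by (cases "min_time F \<Omega> x") auto
  have "w - x \<in> (\<lambda>v. t *\<^sub>R v) ` F"
    using assms by (auto simp: gen_proj_def t)
  then show "gauge_fun F (w - x) \<le> min_time F \<Omega> x"
    unfolding gauge_fun_def t(1) using t(2) by (blast intro: Inf_lower)
  show "min_time F \<Omega> x \<le> gauge_fun F (w - x)"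
    by (rule min_time_le_gauge) fact
qed

text \<open>Boundedness of \<open>F\<close> makes the points of \<open>\<Omega>\<close> that are reached in short time close to \<open>x\<close>, so
  zero minimal time would put \<open>x\<close> in the closure of \<open>\<Omega>\<close>.\<close>

lemma min_time_pos:
  fixes F \<Omega> :: "'a::real_normed_vector set"
  assumes "closed \<Omega>" "bounded F" "x \<notin> \<Omega>"
  shows "0 < min_time F \<Omega> x"
proof (rule ccontr)
  assume "\<not> 0 < min_time F \<Omega> x"
  then have T0: "min_time F \<Omega> x = 0"
    using min_time_nonneg[of F \<Omega> x] by simp
  obtain B where "B > 0" and B: "\<And>v. v \<in> F \<Longrightarrow> norm v \<le> B"
    using \<open>bounded F\<close> by (auto simp: bounded_pos)
  have "\<exists>y\<in>\<Omega>. dist y x < e" if "e > 0" for e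
  proof -
    have "min_time F \<Omega> x < ereal (e / B)"
      using \<open>B > 0\<close> \<open>e > 0\<close> by (simp add: T0)
    then obtain t v where t: "0 \<le> t" "t < e / B" and v: "v \<in> F" "x + t *\<^sub>R v \<in> \<Omega>"
      by (auto simp: min_time_def Inf_less_iff)
    have "dist (x + t *\<^sub>R v) x \<le> t * B"
      using t B[OF v(1)] by (simp add: dist_norm mult_left_mono)
    also have "\<dots> < e"
      using t \<open>B > 0\<close> by (simp add: field_simps)
    finally show ?thesis using v by blast
  qed
  then have "x \<in> closure \<Omega>"
    by (simp add: closure_approachable)
  then show False using assms by simp
qed

text \<open>The gauge grows at most at unit rate in the directions of \<open>F\<close>: a convex combination of two
  points of \<open>F\<close> shows that \<open>t *\<^sub>R a + s *\<^sub>R v \<in> (t + s) *\<^sub>R F\<close>.\<close>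

lemma gauge_fun_add_le:
  assumes "convex F" "v \<in> F" "0 \<le> s"
  shows "gauge_fun F (u + s *\<^sub>R v) \<le> gauge_fun F u + ereal s"
proof -
  have "gauge_fun F (u + s *\<^sub>R v) - ereal s \<le> gauge_fun F u"
    unfolding gauge_fun_def[of F u]
  proof (rule Inf_greatest)
    fix z assume "z \<in> {ereal t |t. 0 \<le> t \<and> u \<in> (\<lambda>v. t *\<^sub>R v) ` F}"
    then obtain t a where z: "z = ereal t" and t: "0 \<le> t" and u: "u = t *\<^sub>R a" and "a \<in> F"
      by blast
    have "u + s *\<^sub>R v \<in> (\<lambda>v. (t + s) *\<^sub>R v) ` F"
    proof (cases "t + s = 0")
      case True
      then have "u + s *\<^sub>R v = (t + s) *\<^sub>R v"
        using t \<open>0 \<le> s\<close> u by (simp add: add_nonneg_eq_0_iff)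
      then show ?thesis using \<open>v \<in> F\<close> by blast
    next
      case False
      have "(t / (t + s)) *\<^sub>R a + (s / (t + s)) *\<^sub>R v \<in> F"
        using assms t False \<open>a \<in> F\<close>
        by (intro convexD) (auto simp: add_divide_distrib[symmetric])
      moreover have "u + s *\<^sub>R v = (t + s) *\<^sub>R ((t / (t + s)) *\<^sub>R a + (s / (t + s)) *\<^sub>R v)"
        using False by (simp add: u scaleR_add_right)
      ultimately show ?thesis by blast
    qed
    then have "gauge_fun F (u + s *\<^sub>R v) \<le> ereal (t + s)"
      unfolding gauge_fun_def using t \<open>0 \<le> s\<close> by (intro Inf_lower) auto
    then show "gauge_fun F (u + s *\<^sub>R v) - ereal s \<le> z"
      unfolding z by (cases "gauge_fun F (u + s *\<^sub>R v)") auto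
  qed
  then show ?thesis
    by (simp add: ereal_minus_le)
qed

section \<open>Approximate subgradients at a projection pair\<close>

lemma eps_subdiff_min_time_imp_gauge:
  fixes F \<Omega> :: "'a::real_normed_vector set"
  assumes f: "f \<in> eps_subdiff \<epsilon> (min_time F \<Omega>) x" and w: "w \<in> gen_proj F \<Omega> x"
  shows "- f \<in> eps_subdiff \<epsilon> (gauge_fun F) (w - x)"
proof -
  have "w \<in> \<Omega>" and finT: "\<bar>min_time F \<Omega> x\<bar> \<noteq> \<infinity>"
    using w min_time_nonneg[of F \<Omega> x] by (auto simp: gen_proj_def split: if_splits)
  note eq = gen_proj_gauge_eq[OF w]
  show ?thesis
  proof (subst mem_eps_subdiff_iff, simp add: eq finT, intro allI impI)
    fix \<delta> assume "\<epsilon> < \<delta>"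
    then obtain d where "d > 0" and d: "\<And>h. norm h < d \<Longrightarrow>
        min_time F \<Omega> x + ereal (blinfun_apply f h - \<delta> * norm h) \<le> min_time F \<Omega> (x + h)"
      using f mem_eps_subdiff_iff[of "min_time F \<Omega>", OF finT] by blast
    have "gauge_fun F (w - x) + ereal (blinfun_apply (- f) h - \<delta> * norm h) \<le> gauge_fun F (w - x + h)"
      if "norm h < d" for h
    proof -
      have "min_time F \<Omega> x + ereal (blinfun_apply f (- h) - \<delta> * norm (- h)) \<le> min_time F \<Omega> (x + - h)"
        by (rule d) (simp add: that)
      also have "\<dots> \<le> gauge_fun F (w - (x + - h))"
        by (rule min_time_le_gauge) fact
      finally show ?thesis
        by (simp add: eq blinfun.minus_left blinfun.minus_right algebra_simps)
    qed
    then show "\<exists>d>0. \<forall>h. norm h < d \<longrightarrow>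
        gauge_fun F (w - x) + ereal (blinfun_apply (- f) h - \<delta> * norm h) \<le> gauge_fun F (w - x + h)"
      using \<open>d > 0\<close> by blast
  qed
qed

text \<open>The factor \<open>\<mu>\<close> covers the rescaled subgradients in the definition of the singular
  subdifferential.\<close>

lemma eps_subdiff_min_time_imp_normal:
  fixes F \<Omega> :: "'a::real_normed_vector set"
  assumes f: "f \<in> eps_subdiff \<epsilon> (min_time F \<Omega>) x" and w: "w \<in> gen_proj F \<Omega> x" and \<mu>: "0 < \<mu>"
  shows "\<mu> *\<^sub>R f \<in> eps_normals (\<mu> * \<epsilon>) \<Omega> w"
proof (rule eps_normalsI)
  show "w \<in> \<Omega>" using w by (auto simp: gen_proj_def split: if_splits)
  have finT: "\<bar>min_time F \<Omega> x\<bar> \<noteq> \<infinity>"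
    using w min_time_nonneg[of F \<Omega> x] by (auto simp: gen_proj_def split: if_splits)
  note eq = gen_proj_gauge_eq[OF w]
  fix \<delta> assume "\<mu> * \<epsilon> < \<delta>"
  then have "\<epsilon> < \<delta> / \<mu>" using \<mu> by (simp add: field_simps)
  then obtain d where "d > 0" and d: "\<And>h. norm h < d \<Longrightarrow>
      min_time F \<Omega> x + ereal (blinfun_apply f h - \<delta> / \<mu> * norm h) \<le> min_time F \<Omega> (x + h)"
    using f mem_eps_subdiff_iff[of "min_time F \<Omega>", OF finT] by blast
  have "blinfun_apply (\<mu> *\<^sub>R f) (u - w) \<le> \<delta> * norm (u - w)" if "u \<in> \<Omega>" "norm (u - w) < d" for u
  proof -
    have "min_time F \<Omega> x + ereal (blinfun_apply f (u - w) - \<delta> / \<mu> * norm (u - w))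
        \<le> min_time F \<Omega> (x + (u - w))"
      by (rule d) fact
    also have "\<dots> \<le> gauge_fun F (u - (x + (u - w)))"
      by (rule min_time_le_gauge) fact
    also have "\<dots> = min_time F \<Omega> x"
      by (simp add: eq[symmetric])
    finally have "blinfun_apply f (u - w) \<le> \<delta> / \<mu> * norm (u - w)"
      using finT by (cases "min_time F \<Omega> x") auto
    then show ?thesis
      using \<mu> by (simp add: blinfun.scaleR_left field_simps)
  qed
  then show "\<exists>d>0. \<forall>u\<in>\<Omega>. norm (u - w) < d \<longrightarrow> blinfun_apply (\<mu> *\<^sub>R f) (u - w) \<le> \<delta> * norm (u - w)"
    using \<open>d > 0\<close> by blast
qed

lemma eps_subdiff_gauge_le:
  fixes F :: "'a::real_normed_vector set"
  assumes "convex F" "v \<in> F" and g: "g \<in> eps_subdiff \<epsilon> (gauge_fun F) u"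
  shows "blinfun_apply g v \<le> 1 + \<epsilon> * norm v"
proof (rule field_le_epsilon)
  fix e :: real assume "0 < e"
  have fin: "\<bar>gauge_fun F u\<bar> \<noteq> \<infinity>"
    using g gauge_fun_nonneg[of F u] by (auto simp: eps_subdiff_def)
  \<comment> \<open>\<open>\<delta> * norm v\<close> exceeds \<open>\<epsilon> * norm v\<close> by at most \<open>e\<close>; the summand 1 covers \<open>v = 0\<close>.\<close>
  define \<delta> where "\<delta> = \<epsilon> + e / (norm v + 1)"
  have "\<epsilon> < \<delta>" using \<open>0 < e\<close> by (simp add: \<delta>_def add_nonneg_pos)
  then obtain d where "d > 0" and d: "\<And>h. norm h < d \<Longrightarrow>
      gauge_fun F u + ereal (blinfun_apply g h - \<delta> * norm h) \<le> gauge_fun F (u + h)"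
    using g mem_eps_subdiff_iff[of "gauge_fun F", OF fin] by blast
  define s where "s = d / (norm v + 1)"
  have "s > 0" using \<open>d > 0\<close> by (simp add: s_def add_nonneg_pos)
  have "norm (s *\<^sub>R v) < d"
    using \<open>d > 0\<close> by (simp add: s_def field_simps add_pos_nonneg)
  then have "gauge_fun F u + ereal (blinfun_apply g (s *\<^sub>R v) - \<delta> * norm (s *\<^sub>R v))
      \<le> gauge_fun F (u + s *\<^sub>R v)"
    by (rule d)
  also have "\<dots> \<le> gauge_fun F u + ereal s"
    by (rule gauge_fun_add_le) (use assms \<open>s > 0\<close> in auto)
  finally have "blinfun_apply g (s *\<^sub>R v) - \<delta> * norm (s *\<^sub>R v) \<le> s"
    using fin by (cases "gauge_fun F u") auto
  then have "s * (blinfun_apply g v - \<delta> * norm v) \<le> s * 1"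
    using \<open>s > 0\<close> by (simp add: blinfun.scaleR_right algebra_simps)
  then have "blinfun_apply g v - \<delta> * norm v \<le> 1"
    using \<open>s > 0\<close> by (simp only: mult_le_cancel_left_pos)
  moreover have "\<delta> * norm v \<le> \<epsilon> * norm v + e"
    using \<open>0 < e\<close> norm_ge_zero[of v]
    by (simp add: \<delta>_def algebra_simps divide_le_eq add_nonneg_pos not_less)
  ultimately show "blinfun_apply g v \<le> 1 + \<epsilon> * norm v + e" by simp
qed

lemma singular_subdiff_gauge_imp_dual_cone:
  fixes F :: "'a::real_normed_vector set"
  assumes "convex F" and y: "y \<in> singular_subdiff (gauge_fun F) u"
  shows "- y \<in> dual_cone F"
proof -
  obtain \<epsilon> \<mu> x g where \<epsilon>: "\<epsilon> \<longlonglongrightarrow> 0" and \<mu>: "\<And>k. 0 < \<mu> k" "\<mu> \<longlonglongrightarrow> 0"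
    and g: "\<And>k. g k \<in> eps_subdiff (\<epsilon> k) (gauge_fun F) (x k)"
    and w: "weak_star_tendsto (\<lambda>k. \<mu> k *\<^sub>R g k) y"
    using y unfolding singular_subdiff_def by blast
  have "blinfun_apply y v \<le> 0" if "v \<in> F" for v
  proof (rule LIMSEQ_le)
    show "(\<lambda>k. blinfun_apply (\<mu> k *\<^sub>R g k) v) \<longlonglongrightarrow> blinfun_apply y v"
      using w by (simp add: weak_star_tendsto_def)
    have "(\<lambda>k. \<mu> k * (1 + \<epsilon> k * norm v)) \<longlonglongrightarrow> 0 * (1 + 0 * norm v)"
      by (intro tendsto_intros \<epsilon> \<mu>)
    then show "(\<lambda>k. \<mu> k * (1 + \<epsilon> k * norm v)) \<longlonglongrightarrow> 0" by simp
    show "\<exists>N. \<forall>n\<ge>N. blinfun_apply (\<mu> n *\<^sub>R g n) v \<le> \<mu> n * (1 + \<epsilon> n * norm v)"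
      using eps_subdiff_gauge_le[OF \<open>convex F\<close> that g] \<mu>(1)
      by (auto simp: blinfun.scaleR_left)
  qed
  then show ?thesis by (simp add: dual_cone_def blinfun.minus_left)
qed

section \<open>Convergence of projections under well-posedness\<close>

lemma well_posed_projections:
  fixes F \<Omega> :: "'a::real_normed_vector set"
  assumes \<Omega>: "closed \<Omega>" and F: "closed F" "bounded F"
    and x0: "xbar \<notin> \<Omega>" "min_time F \<Omega> xbar < \<infinity>" and wp: "well_posed_at F \<Omega> xbar"
    and x: "x \<longlonglongrightarrow> xbar" and fin: "\<And>k. min_time F \<Omega> (x k) < \<infinity>"
    and T: "(\<lambda>k. min_time F \<Omega> (x k)) \<longlonglongrightarrow> min_time F \<Omega> xbar"
  obtains r w wbar where "strict_mono (r :: nat \<Rightarrow> nat)" "\<And>k. w k \<in> gen_proj F \<Omega> (x (r k))"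
    "w \<longlonglongrightarrow> wbar" "wbar \<in> gen_proj F \<Omega> xbar"
proof -
  obtain w0 r where w0: "\<And>k. w0 k \<in> gen_proj F \<Omega> (x k)" and r: "strict_mono (r :: nat \<Rightarrow> nat)"
    and "convergent (w0 \<circ> r)"
    using wp x fin T unfolding well_posed_at_def by blast
  define w where "w = (\<lambda>k. w0 (r k))"
  then obtain wbar where w: "w \<longlonglongrightarrow> wbar"
    using \<open>convergent (w0 \<circ> r)\<close> by (auto simp: convergent_def o_def)
  have wp': "w k \<in> gen_proj F \<Omega> (x (r k))" for k
    by (simp add: w_def w0)
  have "wbar \<in> \<Omega>"
  proof (rule closed_sequentially[OF \<Omega> _ w])
    show "w k \<in> \<Omega>" for k using wp'[of k] by (auto simp: gen_proj_def split: if_splits)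
  qed
  define \<tau> where "\<tau> = (\<lambda>k. real_of_ereal (min_time F \<Omega> (x (r k))))"
  obtain \<tau>0 where \<tau>0: "min_time F \<Omega> xbar = ereal \<tau>0" "\<tau>0 > 0"
    using min_time_pos[OF \<Omega> F(2) x0(1)] x0(2) by (cases "min_time F \<Omega> xbar") auto
  have "(\<lambda>k. min_time F \<Omega> (x (r k))) \<longlonglongrightarrow> ereal \<tau>0"
    using LIMSEQ_subseq_LIMSEQ[OF T r] by (simp add: \<tau>0 o_def)
  then have \<tau>: "\<tau> \<longlonglongrightarrow> \<tau>0"
    unfolding \<tau>_def by (rule lim_real_of_ereal)
  have xr: "(\<lambda>k. x (r k)) \<longlonglongrightarrow> xbar"
    using LIMSEQ_subseq_LIMSEQ[OF x r] by (simp add: o_def)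
  define vbar where "vbar = inverse \<tau>0 *\<^sub>R (wbar - xbar)"
  have "(\<lambda>k. inverse (\<tau> k) *\<^sub>R (w k - x (r k))) \<longlonglongrightarrow> vbar"
    unfolding vbar_def using \<tau>0 by (intro tendsto_intros \<tau> w xr) auto
  moreover have "\<forall>\<^sub>F k in sequentially. inverse (\<tau> k) *\<^sub>R (w k - x (r k)) \<in> F"
    using order_tendstoD(1)[OF \<tau> \<tau>0(2)]
  proof eventually_elim
    fix k assume "0 < \<tau> k"
    moreover obtain v where "v \<in> F" "w k = x (r k) + \<tau> k *\<^sub>R v"
      using wp'[of k] by (auto simp: gen_proj_def \<tau>_def split: if_splits)
    ultimately show "inverse (\<tau> k) *\<^sub>R (w k - x (r k)) \<in> F" by simp
  qed
  ultimately have "vbar \<in> F"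
    by (intro Lim_in_closed_set[OF F(1)]) auto
  moreover have "wbar = xbar + \<tau>0 *\<^sub>R vbar"
    using \<tau>0 by (simp add: vbar_def)
  ultimately have "wbar \<in> gen_proj F \<Omega> xbar"
    using \<open>wbar \<in> \<Omega>\<close> by (auto simp: gen_proj_def \<tau>0)
  with that r wp' w show ?thesis by blast
qed

section \<open>Limiting subgradients of the minimal time function\<close>

theorem theorem6p3:
  fixes \<Omega> F :: "'a::banach set" and xbar :: 'a
  assumes "\<Omega> \<noteq> {}" and "closed \<Omega>"
    and "F \<noteq> {}" and "closed F" and "bounded F" and "convex F"
    and "xbar \<notin> \<Omega>" and "min_time F \<Omega> xbar < \<infinity>"
    and "well_posed_at F \<Omega> xbar"
  shows "basic_subdiff (min_time F \<Omega>) xbar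
           \<subseteq> (\<Union>wbar \<in> gen_proj F \<Omega> xbar.
                uminus ` basic_subdiff (gauge_fun F) (wbar - xbar) \<inter> normal_cone \<Omega> wbar)
       \<and> singular_subdiff (min_time F \<Omega>) xbar
           \<subseteq> (\<Union>wbar \<in> gen_proj F \<Omega> xbar.
                uminus ` singular_subdiff (gauge_fun F) (wbar - xbar) \<inter> normal_cone \<Omega> wbar)
       \<and> (\<Union>wbar \<in> gen_proj F \<Omega> xbar.
            uminus ` singular_subdiff (gauge_fun F) (wbar - xbar) \<inter> normal_cone \<Omega> wbar)
           \<subseteq> (\<Union>wbar \<in> gen_proj F \<Omega> xbar. normal_cone \<Omega> wbar \<inter> dual_cone F)"
proof (intro conjI)
  let ?T = "min_time F \<Omega>"
  note projections = well_posed_projections[OF assms(2,4,5,7,8,9)]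
  show "basic_subdiff ?T xbar
     \<subseteq> (\<Union>wbar \<in> gen_proj F \<Omega> xbar.
          uminus ` basic_subdiff (gauge_fun F) (wbar - xbar) \<inter> normal_cone \<Omega> wbar)"
  proof
    fix f assume "f \<in> basic_subdiff ?T xbar"
    then obtain \<epsilon> x g where \<epsilon>: "\<And>k. 0 \<le> \<epsilon> k" "\<epsilon> \<longlonglongrightarrow> 0" and x: "x \<longlonglongrightarrow> xbar"
      and T: "(\<lambda>k. ?T (x k)) \<longlonglongrightarrow> ?T xbar" and g: "\<And>k. g k \<in> eps_subdiff (\<epsilon> k) ?T (x k)"
      and gf: "weak_star_tendsto g f"
      unfolding basic_subdiff_def by blast
    have fin: "?T (x k) < \<infinity>" for k
      using g[of k] by (simp add: eps_subdiff_def)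
    obtain r w wbar where r: "strict_mono (r :: nat \<Rightarrow> nat)"
      and wk: "\<And>k. w k \<in> gen_proj F \<Omega> (x (r k))" and w: "w \<longlonglongrightarrow> wbar"
      and wbar: "wbar \<in> gen_proj F \<Omega> xbar"
      by (rule projections[OF x fin T]) (rule that)
    have sub: "(\<lambda>k. \<epsilon> (r k)) \<longlonglongrightarrow> 0" "(\<lambda>k. x (r k)) \<longlonglongrightarrow> xbar"
      "(\<lambda>k. ?T (x (r k))) \<longlonglongrightarrow> ?T xbar"
      using LIMSEQ_subseq_LIMSEQ[OF \<epsilon>(2) r] LIMSEQ_subseq_LIMSEQ[OF x r]
        LIMSEQ_subseq_LIMSEQ[OF T r] by (simp_all add: o_def)
    have gf': "weak_star_tendsto (\<lambda>k. g (r k)) f"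
      by (rule weak_star_tendsto_subseq[OF gf r])
    have "f \<in> normal_cone \<Omega> wbar"
      unfolding normal_cone_def mem_Collect_eq
    proof (intro exI conjI allI)
      show "g (r k) \<in> eps_normals (\<epsilon> (r k)) \<Omega> (w k)" for k
        using eps_subdiff_min_time_imp_normal[OF g wk, of 1 k] by simp
    qed (use \<epsilon> sub w gf' in auto)
    moreover have "- f \<in> basic_subdiff (gauge_fun F) (wbar - xbar)"
      unfolding basic_subdiff_def mem_Collect_eq
    proof (intro exI conjI allI)
      show "- g (r k) \<in> eps_subdiff (\<epsilon> (r k)) (gauge_fun F) (w k - x (r k))" for k
        by (rule eps_subdiff_min_time_imp_gauge[OF g wk])
      show "(\<lambda>k. gauge_fun F (w k - x (r k))) \<longlonglongrightarrow> gauge_fun F (wbar - xbar)"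
        using sub(3) by (simp add: gen_proj_gauge_eq[OF wk] gen_proj_gauge_eq[OF wbar])
      show "gauge_fun F (wbar - xbar) < \<infinity>"
        using assms(8) by (simp add: gen_proj_gauge_eq[OF wbar])
      show "(\<lambda>k. w k - x (r k)) \<longlonglongrightarrow> wbar - xbar"
        by (intro tendsto_diff w sub)
    qed (use \<epsilon> sub weak_star_tendsto_uminus[OF gf'] in auto)
    ultimately show "f \<in> (\<Union>wbar \<in> gen_proj F \<Omega> xbar.
        uminus ` basic_subdiff (gauge_fun F) (wbar - xbar) \<inter> normal_cone \<Omega> wbar)"
      using wbar by (auto intro!: image_eqI[of f uminus "- f"])
  qed
  show "singular_subdiff ?T xbar
     \<subseteq> (\<Union>wbar \<in> gen_proj F \<Omega> xbar.
          uminus ` singular_subdiff (gauge_fun F) (wbar - xbar) \<inter> normal_cone \<Omega> wbar)"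
  proof
    fix f assume "f \<in> singular_subdiff ?T xbar"
    then obtain \<epsilon> \<mu> x g where \<epsilon>: "\<And>k. 0 \<le> \<epsilon> k" "\<epsilon> \<longlonglongrightarrow> 0"
      and \<mu>: "\<And>k. 0 < \<mu> k" "\<mu> \<longlonglongrightarrow> 0" and x: "x \<longlonglongrightarrow> xbar"
      and T: "(\<lambda>k. ?T (x k)) \<longlonglongrightarrow> ?T xbar" and g: "\<And>k. g k \<in> eps_subdiff (\<epsilon> k) ?T (x k)"
      and gf: "weak_star_tendsto (\<lambda>k. \<mu> k *\<^sub>R g k) f"
      unfolding singular_subdiff_def by blast
    have fin: "?T (x k) < \<infinity>" for k
      using g[of k] by (simp add: eps_subdiff_def)
    obtain r w wbar where r: "strict_mono (r :: nat \<Rightarrow> nat)"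
      and wk: "\<And>k. w k \<in> gen_proj F \<Omega> (x (r k))" and w: "w \<longlonglongrightarrow> wbar"
      and wbar: "wbar \<in> gen_proj F \<Omega> xbar"
      by (rule projections[OF x fin T]) (rule that)
    have sub: "(\<lambda>k. \<epsilon> (r k)) \<longlonglongrightarrow> 0" "(\<lambda>k. x (r k)) \<longlonglongrightarrow> xbar"
      "(\<lambda>k. ?T (x (r k))) \<longlonglongrightarrow> ?T xbar" "(\<lambda>k. \<mu> (r k)) \<longlonglongrightarrow> 0"
      using LIMSEQ_subseq_LIMSEQ[OF \<epsilon>(2) r] LIMSEQ_subseq_LIMSEQ[OF x r]
        LIMSEQ_subseq_LIMSEQ[OF T r] LIMSEQ_subseq_LIMSEQ[OF \<mu>(2) r] by (simp_all add: o_def)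
    have gf': "weak_star_tendsto (\<lambda>k. \<mu> (r k) *\<^sub>R g (r k)) f"
      by (rule weak_star_tendsto_subseq[OF gf r])
    have "f \<in> normal_cone \<Omega> wbar"
      unfolding normal_cone_def mem_Collect_eq
    proof (intro exI conjI allI)
      show "\<mu> (r k) *\<^sub>R g (r k) \<in> eps_normals (\<mu> (r k) * \<epsilon> (r k)) \<Omega> (w k)" for k
        by (rule eps_subdiff_min_time_imp_normal[OF g wk \<mu>(1)])
      show "(\<lambda>k. \<mu> (r k) * \<epsilon> (r k)) \<longlonglongrightarrow> 0"
        using tendsto_mult[OF sub(4) sub(1)] by simp
      show "0 \<le> \<mu> (r k) * \<epsilon> (r k)" for k
        using \<mu>(1)[of "r k"] \<epsilon>(1)[of "r k"] by simp
    qed (use w gf' in auto)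
    moreover have "- f \<in> singular_subdiff (gauge_fun F) (wbar - xbar)"
      unfolding singular_subdiff_def mem_Collect_eq
    proof (intro exI conjI allI)
      show "- g (r k) \<in> eps_subdiff (\<epsilon> (r k)) (gauge_fun F) (w k - x (r k))" for k
        by (rule eps_subdiff_min_time_imp_gauge[OF g wk])
      show "(\<lambda>k. gauge_fun F (w k - x (r k))) \<longlonglongrightarrow> gauge_fun F (wbar - xbar)"
        using sub(3) by (simp add: gen_proj_gauge_eq[OF wk] gen_proj_gauge_eq[OF wbar])
      show "gauge_fun F (wbar - xbar) < \<infinity>"
        using assms(8) by (simp add: gen_proj_gauge_eq[OF wbar])
      show "(\<lambda>k. w k - x (r k)) \<longlonglongrightarrow> wbar - xbar"
        by (intro tendsto_diff w sub)
      show "weak_star_tendsto (\<lambda>k. \<mu> (r k) *\<^sub>R - g (r k)) (- f)"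
        using weak_star_tendsto_uminus[OF gf'] by simp
    qed (use \<epsilon> \<mu> sub in auto)
    ultimately show "f \<in> (\<Union>wbar \<in> gen_proj F \<Omega> xbar.
        uminus ` singular_subdiff (gauge_fun F) (wbar - xbar) \<inter> normal_cone \<Omega> wbar)"
      using wbar by (auto intro!: image_eqI[of f uminus "- f"])
  qed
  show "(\<Union>wbar \<in> gen_proj F \<Omega> xbar.
        uminus ` singular_subdiff (gauge_fun F) (wbar - xbar) \<inter> normal_cone \<Omega> wbar)
      \<subseteq> (\<Union>wbar \<in> gen_proj F \<Omega> xbar. normal_cone \<Omega> wbar \<inter> dual_cone F)"
    using singular_subdiff_gauge_imp_dual_cone[OF assms(6)] by blast
qed

end
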